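(* Let $\mathrm{Alph}$ be a finite set of (non-integer) symbols, let $m\ge 1$ and $\mathrm{Int}=\{1,\dots,m\}$. Fix a maximum input length $n_0>1$. (1) There exists a (single-layer, single-head) Transformer $T_{\mathrm{Index}}$ over the vocabulary $\mathrm{Alph}\cup\mathrm{Int}$ with a two-dimensional RoPE-based attention module with some angle $\theta$, such that for every input $\bar\sigma$ that is valid for the multi-hop number task and has length $n\le n_0$, $$T_{\mathrm{Index}}(\bar\sigma)=\mathrm{Index}(\bar\sigma).$$ (2) Furthermore, there exists a (single-layer, single-head) Transformer $T_{\mathrm{Retrieval}}$ over the vocabulary $\mathrm{Alph}\times(\mathrm{Alph}\cup\mathrm{Int})$ with a two-dimensional RoPE-based attention module with some angle $\theta$, such that for every input $\bar\sigma$ that is valid for the multi-hop letter task and has length $n\le n_0$, $$T_{\mathrm{Retrieval}}(\bar\sigma)=\mathrm{Retrieval}(\bar\sigma).$$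
   Context: **Transformers.** For an angle $\theta>0$ let $\rho(\theta)=\begin{pmatrix}\cos\theta&-\sin\theta\\ \sin\theta&\cos\theta\end{pmatrix}$. A single-layer, single-head decoder-only Transformer over a finite vocabulary $\Sigma$, with a two-dimensional RoPE-based (softmax) attention module with angle $\theta$, is given by: a dimension $d\ge1$; an embedding $E:\Sigma\to\mathbb{R}^d$; query and key matrices $W^Q,W^K\in\mathbb{R}^{2\times d}$; a continuous value function $\mathrm{Val}:\mathbb{R}^d\to\mathbb{R}^d$; and a continuous function $F:\mathbb{R}^d\times\mathbb{R}^d\to\mathbb{R}^{\Sigma}$ producing one output score per symbol. On input $\bar\sigma=(\sigma_1,\dots,\sigma_n)\in\Sigma^n$, for $1\le j\le i\le n$ the logits are $$\lambda^i_j=(W^KE(\sigma_j))^\top\rho(\theta)^{i-j}\,W^QE(\sigma_i),$$ the attention weights are $w^i_j=\exp(\lambda^i_j)/\sum_{k\le i}\exp(\lambda^i_k)$, and the attention vectors are $a_i=\sum_{j\le i}w^i_j\,\mathrm{Val}(E(\sigma_j))$. The output symbol $T(\bar\sigma)_i$ at position $i$ is the unique $\sigma\in\Sigma$ maximizing the coordinate $F(E(\sigma_i),a_i)_\sigma$; the equality $T(\bar\sigma)=f(\bar\sigma)$ means that for each $i\le n$ this maximizer is unique and equals $f(\bar\sigma)_i$. **Index function.** Let $\Sigma=\mathrm{Alph}\cup\mathrm{Int}$. For $\bar\sigma\in\Sigma^n$ of length $n>m$, $\mathrm{Index}(\bar\sigma)\in\Sigma^n$ is defined at position $j\le n$ as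 follows. If $\sigma_j=i\in\mathrm{Int}$, then $\mathrm{Index}(\bar\sigma)_j=\sigma_{j-i}$ if $\sigma_{j-i}\in\mathrm{Alph}$, and $\mathrm{Index}(\bar\sigma)_j=\sigma_j$ otherwise. If $\sigma_j\in\mathrm{Alph}$, then $\mathrm{Index}(\bar\sigma)_j=\sigma_j$. **Valid inputs for the number task.** These are sequences $\bar\sigma=s_1\cdots s_{n_1}j_1\cdots j_{n_2}$ of length $n=n_1+n_2$ (with $n>m$, as required for $\mathrm{Index}$), where $n_1,n_2>0$, $s_i\in\mathrm{Alph}$, $j_i\in\mathrm{Int}$, for which there are $H\ge1$ and indices $k_1,\dots,k_H\in\{1,\dots,n_2\}$ with $k_1=n_2$; $k_i-k_{i+1}=j_{k_i}$ for $1\le i\le H-1$; and $n_1+k_H-j_{k_H}\in\{1,\dots,n_1\}$ (the last hop lands on one of the letters $s_1,\dots,s_{n_1}$). **Retrieval function.** Let $\Sigma=\mathrm{Alph}\times(\mathrm{Alph}\cup\mathrm{Int})$ and write $\sigma=\sigma^{L}\sigma^{R}$ for $\sigma\in\Sigma$. A sequence $\bar\sigma\in\Sigma^n$ is *proper* if for every $j\le n$ with $\sigma_j^R\in\mathrm{Alph}$ there is a position $k_j\le j$ with $\sigma_{k_j}^L=\sigma_j^R$, and for any other position $k\le j$ with $\sigma_k^L=\sigma_j^R$ one has $\sigma_k=\sigma_{k_j}$. For proper $\bar\sigma$, $\mathrm{Retrieval}(\bar\sigma)\in\Sigma^n$ is defined by $\mathrm{Retrieval}(\bar\sigma)_j=\sigma_{k_j}$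 if $\sigma_j\in\mathrm{Alph}\times\mathrm{Alph}$, and $\mathrm{Retrieval}(\bar\sigma)_j=\sigma_j$ if $\sigma_j\in\mathrm{Alph}\times\mathrm{Int}$. **Valid inputs for the letter task.** These are sequences $\bar\sigma=(s_1,w_1)\cdots(s_{n_1},w_{n_1})(x_1,y_1)\cdots(x_{n_2},y_{n_2})$ of length $n=n_1+n_2$ (proper, as required for $\mathrm{Retrieval}$), where $n_1,n_2>0$, $s_i,x_i,y_i\in\mathrm{Alph}$, $w_i\in\mathrm{Int}$, for which there are $H\ge 1$ and indices $n_2=k_1>k_2>\dots>k_H\ge1$ with $y_{k_i}=x_{k_{i+1}}$ for $1\le i\le H-1$, and some $i^*\in\{1,\dots,n_1\}$ with $y_{k_H}=s_{i^*}$. *)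

theory Defs
  imports "HOL-Analysis.Analysis"
begin

text \<open>
  Sequences are lists; positions are counted from 1, as in the mathematics.
  \<open>xs !. i\<close> is only meaningful for \<open>1 \<le> i \<le> length xs\<close>, and is only used there.
\<close>

abbreviation nth1 :: "'b list \<Rightarrow> nat \<Rightarrow> 'b"  (infixl "!." 100)
  where "xs !. i \<equiv> xs ! (i - 1)"


subsection \<open>Transformers with two-dimensional RoPE attention\<close>

definition rho :: "real \<Rightarrow> real^2^2"
  where "rho \<theta> = vector [vector [cos \<theta>, - sin \<theta>], vector [sin \<theta>, cos \<theta>]]"

text \<open>Matrix powers: \<open>(^)\<close> on type \<open>real^2^2\<close> would be the componentwise power.\<close>

primrec matpow :: "real^'n^'n \<Rightarrow> nat \<Rightarrow> real^'n^'n"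
  where
    "matpow M 0 = mat 1"
  | "matpow M (Suc k) = M ** matpow M k"

text \<open>
  The dimension \<open>d\<close> is part of the data of a Transformer, so it cannot be a type. The space
  \<open>\<real>\<^sup>d\<close> is the topological space \<open>Euclidean_space d\<close>: functions on \<open>nat\<close> vanishing from \<open>d\<close> on.
  A \<open>2 \<times> d\<close> matrix is a pair of rows (type \<open>(nat \<Rightarrow> real)^2\<close>), of which only the entries in columns
  \<open>k < d\<close> are ever used.
\<close>

record 's transformer =
  dim_of :: nat
  angle_of :: real
  emb :: "'s \<Rightarrow> nat \<Rightarrow> real"
  WQ :: "(nat \<Rightarrow> real)^2"
  WK :: "(nat \<Rightarrow> real)^2"
  Val :: "(nat \<Rightarrow> real) \<Rightarrow> nat \<Rightarrow> real"
  Out :: "(nat \<Rightarrow> real) \<Rightarrow> (nat \<Rightarrow> real) \<Rightarrow> 's \<Rightarrow> real"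

text \<open>\<open>powertop_real \<Sigma>\<close> is \<open>\<real>\<^sup>\<Sigma>\<close> with its usual topology.\<close>

definition transformer_over :: "'s set \<Rightarrow> 's transformer \<Rightarrow> bool"
  where "transformer_over \<Sigma> T \<longleftrightarrow>
    dim_of T \<ge> 1 \<and>
    angle_of T > 0 \<and>
    emb T \<in> \<Sigma> \<rightarrow> topspace (Euclidean_space (dim_of T)) \<and>
    continuous_map (Euclidean_space (dim_of T)) (Euclidean_space (dim_of T)) (Val T) \<and>
    continuous_map (prod_topology (Euclidean_space (dim_of T)) (Euclidean_space (dim_of T)))
      (powertop_real \<Sigma>) (\<lambda>(x, a). Out T x a)"

definition mat_app :: "nat \<Rightarrow> (nat \<Rightarrow> real)^2 \<Rightarrow> (nat \<Rightarrow> real) \<Rightarrow> real^2"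
  where "mat_app d W x = (\<chi> r. \<Sum>k<d. (W $ r) k * x k)"

definition logit :: "'s transformer \<Rightarrow> 's list \<Rightarrow> nat \<Rightarrow> nat \<Rightarrow> real"
  where "logit T \<sigma> i j =
    mat_app (dim_of T) (WK T) (emb T (\<sigma> !. j)) \<bullet>
      (matpow (rho (angle_of T)) (i - j) *v mat_app (dim_of T) (WQ T) (emb T (\<sigma> !. i)))"

definition att_weight :: "'s transformer \<Rightarrow> 's list \<Rightarrow> nat \<Rightarrow> nat \<Rightarrow> real"
  where "att_weight T \<sigma> i j = exp (logit T \<sigma> i j) / (\<Sum>k=1..i. exp (logit T \<sigma> i k))"

definition att_vec :: "'s transformer \<Rightarrow> 's list \<Rightarrow> nat \<Rightarrow> nat \<Rightarrow> real"
  where "att_vec T \<sigma> i = (\<lambda>c. \<Sum>j=1..i. att_weight T \<sigma> i j * Val T (emb T (\<sigma> !. j)) c)"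

text \<open>
  \<open>outputs \<Sigma> T \<sigma> \<tau>\<close> renders \<open>T(\<sigma>) = \<tau>\<close>: at every position the set of maximizers of the
  output scores over \<open>\<Sigma>\<close> consists of exactly the corresponding symbol of \<open>\<tau>\<close>.
\<close>

definition outputs :: "'s set \<Rightarrow> 's transformer \<Rightarrow> 's list \<Rightarrow> 's list \<Rightarrow> bool"
  where "outputs \<Sigma> T \<sigma> \<tau> \<longleftrightarrow>
    length \<tau> = length \<sigma> \<and>
    (\<forall>i\<in>{1..length \<sigma>}.
      {s. is_arg_max (Out T (emb T (\<sigma> !. i)) (att_vec T \<sigma> i)) (\<lambda>s. s \<in> \<Sigma>) s} = {\<tau> !. i})"


subsection \<open>The number task\<close>

text \<open>
  The letters form a finite set \<open>A\<close> of an arbitrary type; the disjoint union of letters and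
  integers is the sum \<open>A <+> {1..m}\<close>, with letters tagged \<open>Inl\<close> and integers tagged \<open>Inr\<close>.
\<close>

definition index_vocab :: "'a set \<Rightarrow> nat \<Rightarrow> ('a + nat) set"
  where "index_vocab A m = A <+> {1..m}"

text \<open>
  A hop that leaves the sequence (\<open>j - i \<le> 0\<close>) does not reach a letter, hence falls under
  ``otherwise''; the guard \<open>i < j\<close> is needed because subtraction on \<open>nat\<close> truncates.
\<close>

definition Index :: "('a + nat) list \<Rightarrow> ('a + nat) list"
  where "Index \<sigma> = map (\<lambda>j. case \<sigma> !. j of
      Inr i \<Rightarrow> if i < j \<and> isl (\<sigma> !. (j - i)) then \<sigma> !. (j - i) else \<sigma> !. j
    | Inl _ \<Rightarrow> \<sigma> !. j) [1..<length \<sigma> + 1]"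

definition valid_number :: "'a set \<Rightarrow> nat \<Rightarrow> ('a + nat) list \<Rightarrow> bool"
  where "valid_number A m \<sigma> \<longleftrightarrow>
    (\<exists>ss js. \<sigma> = map Inl ss @ map Inr js \<and>
      length ss > 0 \<and> length js > 0 \<and> length \<sigma> > m \<and>
      set ss \<subseteq> A \<and> set js \<subseteq> {1..m} \<and>
      (\<exists>(H::nat) (k::nat \<Rightarrow> nat). H \<ge> 1 \<and>
        (\<forall>i\<in>{1..H}. k i \<in> {1..length js}) \<and>
        k 1 = length js \<and>
        (\<forall>i. 1 \<le> i \<and> i < H \<longrightarrow> int (k i) - int (k (i + 1)) = int (js !. k i)) \<and>
        int (length ss) + int (k H) - int (js !. k H) \<in> {1..int (length ss)}))"


subsection \<open>The letter task\<close>

definition retrieval_vocab :: "'a set \<Rightarrow> nat \<Rightarrow> ('a \<times> ('a + nat)) set"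
  where "retrieval_vocab A m = A \<times> (A <+> {1..m})"

definition retrieval_pos :: "('a \<times> ('a + nat)) list \<Rightarrow> nat \<Rightarrow> nat \<Rightarrow> bool"
  where "retrieval_pos \<sigma> j k \<longleftrightarrow>
    k \<in> {1..j} \<and> Inl (fst (\<sigma> !. k)) = snd (\<sigma> !. j) \<and>
    (\<forall>k'\<in>{1..j}. k' \<noteq> k \<and> Inl (fst (\<sigma> !. k')) = snd (\<sigma> !. j) \<longrightarrow> \<sigma> !. k' = \<sigma> !. k)"

definition proper :: "('a \<times> ('a + nat)) list \<Rightarrow> bool"
  where "proper \<sigma> \<longleftrightarrow>
    (\<forall>j\<in>{1..length \<sigma>}. isl (snd (\<sigma> !. j)) \<longrightarrow> (\<exists>k. retrieval_pos \<sigma> j k))"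

text \<open>
  The position \<open>k\<^sub>j\<close> need not be unique, but for proper \<open>\<sigma>\<close> the symbol found there does not
  depend on the choice.
\<close>

definition Retrieval :: "('a \<times> ('a + nat)) list \<Rightarrow> ('a \<times> ('a + nat)) list"
  where "Retrieval \<sigma> = map (\<lambda>j.
    if isl (snd (\<sigma> !. j)) then \<sigma> !. (SOME k. retrieval_pos \<sigma> j k) else \<sigma> !. j)
    [1..<length \<sigma> + 1]"

definition valid_letter :: "'a set \<Rightarrow> nat \<Rightarrow> ('a \<times> ('a + nat)) list \<Rightarrow> bool"
  where "valid_letter A m \<sigma> \<longleftrightarrow> proper \<sigma> \<and>
    (\<exists>ps qs. \<sigma> = map (\<lambda>(s, w). (s, Inr w)) ps @ map (\<lambda>(x, y). (x, Inl y)) qs \<and>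
      length ps > 0 \<and> length qs > 0 \<and>
      set ps \<subseteq> A \<times> {1..m} \<and> set qs \<subseteq> A \<times> A \<and>
      (\<exists>(H::nat) (k::nat \<Rightarrow> nat). H \<ge> 1 \<and>
        k 1 = length qs \<and>
        (\<forall>i. 1 \<le> i \<and> i < H \<longrightarrow> k (i + 1) < k i) \<and>
        k H \<ge> 1 \<and>
        (\<forall>i. 1 \<le> i \<and> i < H \<longrightarrow> snd (qs !. k i) = fst (qs !. k (i + 1))) \<and>
        (\<exists>i\<in>{1..length ps}. snd (qs !. k H) = fst (ps !. i))))"

end

theory Submission
  imports Defs
begin

text \<open>
  With a one-hot embedding and the identity as value function, the attention vector at a position
  lists, for every symbol, its share of the total attention weight. Only finitely many inputs
  occur, so some continuous output function realises every target that is a function of the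
  current symbol and of these shares. For the letter task the shares under any attention reveal
  which symbols have occurred, which determines the answer on proper inputs. For the number task
  the rotation is used to make the logit of a letter largest at the distance \<open>r\<close> named by the
  current number, while all numbers get logit 0. If the logits are scaled up enough, the ratio of
  the share of a letter to the share of the symbol \<open>r\<close> itself, whose weight is an integer between
  1 and \<open>n\<^sub>0\<close>, reveals whether that letter stands at distance \<open>r\<close>.
\<close>

subsection \<open>Interpolation by output functions\<close>

lemma continuous_map_Euclidean_space_component:
  "continuous_map (Euclidean_space d) euclideanreal (\<lambda>x. x k)"
  unfolding Euclidean_space_def
  by (intro continuous_map_from_subtopology continuous_map_product_projection) simp

text \<open>The score of \<open>s\<close> is minus the product of the squared distances to the
  points labelled \<open>s\<close>. It is 0 at those points and, because \<open>sep\<close> keeps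
  differently labelled points apart, negative at the others. A symbol labelling no point gets the
  empty product, hence score -1.\<close>

lemma continuous_scores_exist:
  fixes pt :: "'x \<Rightarrow> (nat \<Rightarrow> real) \<times> (nat \<Rightarrow> real)" and g :: "'x \<Rightarrow> 's"
  assumes "finite X"
    and pt: "pt \<in> X \<rightarrow> topspace (prod_topology (Euclidean_space d) (Euclidean_space d))"
    and g: "g \<in> X \<rightarrow> \<Sigma>"
    and sep: "\<forall>x\<in>X. \<forall>y\<in>X. pt x = pt y \<longrightarrow> g x = g y"
  shows "\<exists>G :: (nat \<Rightarrow> real) \<Rightarrow> (nat \<Rightarrow> real) \<Rightarrow> 's \<Rightarrow> real.
    continuous_map (prod_topology (Euclidean_space d) (Euclidean_space d)) (powertop_real \<Sigma>)
      (\<lambda>(x, a). G x a) \<and>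
    (\<forall>x\<in>X. {s. is_arg_max (G (fst (pt x)) (snd (pt x))) (\<lambda>s. s \<in> \<Sigma>) s} = {g x})"
proof -
  define D :: "(nat \<Rightarrow> real) \<times> (nat \<Rightarrow> real) \<Rightarrow> (nat \<Rightarrow> real) \<times> (nat \<Rightarrow> real) \<Rightarrow> real"
    where "D p p' = (\<Sum>k<d. (fst p k - fst p' k)\<^sup>2 + (snd p k - snd p' k)\<^sup>2)" for p p'
  \<comment> \<open>The restriction to \<open>\<Sigma>\<close> makes the values extensional
    functions, as the points of \<open>powertop_real \<Sigma>\<close> are.\<close>
  define G where
    "G x a = (\<lambda>s\<in>\<Sigma>. - (\<Prod>y\<in>{y\<in>X. g y = s}. D (x, a) (pt y)))" for x a
  have D_nonneg: "D p p' \<ge> 0" for p p'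
    unfolding D_def by (intro sum_nonneg) simp
  have D_eq: "p = p'"
    if "D p p' = 0" and p: "p \<in> topspace (prod_topology (Euclidean_space d) (Euclidean_space d))"
      and p': "p' \<in> topspace (prod_topology (Euclidean_space d) (Euclidean_space d))" for p p'
  proof -
    have "\<forall>k<d. (fst p k - fst p' k)\<^sup>2 + (snd p k - snd p' k)\<^sup>2 = 0"
      using that(1) unfolding D_def by (subst (asm) sum_nonneg_eq_0_iff) auto
    then have low: "fst p k = fst p' k \<and> snd p k = snd p' k" if "k < d" for k
      using that by (simp add: sum_power2_eq_zero_iff)
    \<comment> \<open>\<open>D\<close> does not see these coordinates; both points vanish there as
      members of the space.\<close>
    have high: "fst p k = fst p' k \<and> snd p k = snd p' k" if "\<not> k < d" for k
      using p p' that by (auto simp: topspace_Euclidean_space)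
    from low high show ?thesis
      by (metis ext prod_eqI)
  qed
  let ?P = "prod_topology (Euclidean_space d) (Euclidean_space d)"
  have fst_cont: "continuous_map ?P euclideanreal (\<lambda>p. fst p k)" for k
    using continuous_map_compose[OF continuous_map_fst continuous_map_Euclidean_space_component]
    by (simp add: o_def)
  have snd_cont: "continuous_map ?P euclideanreal (\<lambda>p. snd p k)" for k
    using continuous_map_compose[OF continuous_map_snd continuous_map_Euclidean_space_component]
    by (simp add: o_def)
  have D_cont: "continuous_map ?P euclideanreal (\<lambda>p. D p p')" for p'
    unfolding D_def
    by (intro continuous_map_sum continuous_map_add continuous_map_real_pow continuous_map_diff
        fst_cont snd_cont continuous_map_const[THEN iffD2]) auto
  have "continuous_map ?P (powertop_real \<Sigma>) (\<lambda>p. G (fst p) (snd p))"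
    unfolding continuous_map_componentwise G_def using \<open>finite X\<close>
    by (auto intro!: continuous_map_minus continuous_map_prod D_cont)
  then have cont: "continuous_map ?P (powertop_real \<Sigma>) (\<lambda>(x, a). G x a)"
    by (simp add: case_prod_unfold)
  have "{s. is_arg_max (G (fst (pt x)) (snd (pt x))) (\<lambda>s. s \<in> \<Sigma>) s} = {g x}" if x: "x \<in> X" for x
  proof -
    have own: "G (fst (pt x)) (snd (pt x)) (g x) = 0"
      using x g \<open>finite X\<close> unfolding G_def by (auto simp: D_def Pi_iff intro!: prod_zero)
    have other: "G (fst (pt x)) (snd (pt x)) s < 0" if "s \<in> \<Sigma>" "s \<noteq> g x" for s
    proof -
      have "D (pt x) (pt y) > 0" if y: "y \<in> X" "g y = s" for y
      proof -
        have "pt x \<noteq> pt y"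
          using sep x y \<open>s \<noteq> g x\<close> by metis
        then show ?thesis
          using D_eq[of "pt x" "pt y"] D_nonneg[of "pt x" "pt y"] pt x y(1)
          by (metis PiE order_le_less)
      qed
      then show ?thesis
        using that unfolding G_def by (auto intro!: prod_pos)
    qed
    show ?thesis
      using own other g x unfolding is_arg_max_def
      by (auto simp: Pi_iff) (metis less_irrefl, metis less_asym)
  qed
  with cont show ?thesis
    by blast
qed


subsection \<open>Tasks determined by attention shares\<close>

text \<open>The fraction of the attention of position \<open>i\<close> that falls on occurrences of
  \<open>s\<close>. Keys and queries are arbitrary maps on symbols here: under a one-hot embedding
  every such map is given by a matrix.\<close>

definition share :: "('s \<Rightarrow> real^2) \<Rightarrow> ('s \<Rightarrow> real^2) \<Rightarrow> real \<Rightarrow> 's list \<Rightarrow> nat \<Rightarrow> 's \<Rightarrow> real"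
  where "share key query \<theta> \<sigma> i s =
    (\<Sum>j | j \<in> {1..i} \<and> \<sigma> !. j = s.
       exp (key (\<sigma> !. j) \<bullet> (matpow (rho \<theta>) (i - j) *v query (\<sigma> !. i)))) /
    (\<Sum>j=1..i. exp (key (\<sigma> !. j) \<bullet> (matpow (rho \<theta>) (i - j) *v query (\<sigma> !. i))))"

text \<open>Reduces a task to a choice of keys, queries and angle. The output function sees the
  current symbol and its shares only, and \<open>sep\<close> says that these determine the answer,
  which is the condition for interpolating over the finitely many positions of inputs in
  \<open>L\<close>.\<close>

lemma transformer_if_shares_separate:
  fixes \<Sigma> :: "'s set" and f :: "'s list \<Rightarrow> 's list"
  assumes "finite \<Sigma>" and "\<theta> > 0" and "finite L"
    and L: "\<And>\<sigma>. \<sigma> \<in> L \<Longrightarrow> set \<sigma> \<subseteq> \<Sigma>"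
    and f: "\<And>\<sigma>. \<sigma> \<in> L \<Longrightarrow> length (f \<sigma>) = length \<sigma> \<and> set (f \<sigma>) \<subseteq> \<Sigma>"
    and sep: "\<And>\<sigma> i \<sigma>' i'. \<lbrakk>\<sigma> \<in> L; i \<in> {1..length \<sigma>}; \<sigma>' \<in> L; i' \<in> {1..length \<sigma>'};
        \<sigma> !. i = \<sigma>' !. i';
        \<forall>s\<in>\<Sigma>. share key query \<theta> \<sigma> i s = share key query \<theta> \<sigma>' i' s\<rbrakk>
      \<Longrightarrow> f \<sigma> !. i = f \<sigma>' !. i'"
  shows "\<exists>T. transformer_over \<Sigma> T \<and> (\<forall>\<sigma>\<in>L. outputs \<Sigma> T \<sigma> (f \<sigma>))"
proof -
  obtain n and idx :: "'s \<Rightarrow> nat" where idx: "idx ` \<Sigma> = {i. i < n}" "inj_on idx \<Sigma>"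
    using finite_imp_inj_to_nat_seg[OF \<open>finite \<Sigma>\<close>] by metis
  \<comment> \<open>The additional coordinate keeps the dimension positive even if
    \<open>\<Sigma>\<close> is empty; it is 0 in every embedding.\<close>
  define d where "d = Suc n"
  have idx_less: "idx s < d" if "s \<in> \<Sigma>" for s
  proof -
    have "idx s \<in> {i. i < n}"
      using that by (simp flip: idx(1))
    then show ?thesis
      by (simp add: d_def)
  qed
  define E :: "'s \<Rightarrow> nat \<Rightarrow> real" where "E s c = (if c = idx s then 1 else 0)" for s c
  \<comment> \<open>Column \<open>c\<close> is the value of \<open>v\<close> at the symbol numbered
    \<open>c\<close>. Where \<open>c\<close> numbers no symbol the entry is arbitrary, but it only
    meets zeros of the embeddings.\<close>
  define column :: "('s \<Rightarrow> real^2) \<Rightarrow> (nat \<Rightarrow> real)^2"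
    where "column v = (\<chi> r. (\<lambda>c. v (inv_into \<Sigma> idx c) $ r))" for v
  \<comment> \<open>The output function is a placeholder: attention does not depend on it, so the
    points to interpolate can be computed before it is chosen.\<close>
  define T0 :: "'s transformer" where
    "T0 = \<lparr>dim_of = d, angle_of = \<theta>, emb = E, WQ = column query, WK = column key,
           Val = id, Out = (\<lambda>_ _ _. 0)\<rparr>"
  have mat_app_column: "mat_app d (column v) (E s) = v s" if "s \<in> \<Sigma>" for v s
    using that idx(2) idx_less[OF that]
    by (auto simp: mat_app_def column_def E_def vec_eq_iff if_distrib cong: if_cong)
  have E_top: "E s \<in> topspace (Euclidean_space d)" if "s \<in> \<Sigma>" for s
    using idx_less[OF that] by (auto simp: topspace_Euclidean_space E_def)
  have mem: "\<sigma> !. j \<in> \<Sigma>" if "\<sigma> \<in> L" "j \<in> {1..length \<sigma>}" for \<sigma> j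
    using L[OF that(1)] that(2) by (auto simp: subset_iff)
  \<comment> \<open>Stated for every coordinate \<open>c\<close>: coordinates numbering a symbol
    give the shares, and those from \<open>d\<close> on give 0.\<close>
  have att: "att_vec T0 \<sigma> i c =
      (\<Sum>j | j \<in> {1..i} \<and> idx (\<sigma> !. j) = c.
       exp (key (\<sigma> !. j) \<bullet> (matpow (rho \<theta>) (i - j) *v query (\<sigma> !. i)))) /
      (\<Sum>j=1..i. exp (key (\<sigma> !. j) \<bullet> (matpow (rho \<theta>) (i - j) *v query (\<sigma> !. i))))"
    if "\<sigma> \<in> L" "i \<in> {1..length \<sigma>}" for \<sigma> i c
  proof -
    have logit: "logit T0 \<sigma> i j = key (\<sigma> !. j) \<bullet> (matpow (rho \<theta>) (i - j) *v query (\<sigma> !. i))"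
      if j: "j \<in> {1..i}" for j
    proof -
      have "\<sigma> !. j \<in> \<Sigma>" "\<sigma> !. i \<in> \<Sigma>"
        using mem[OF \<open>\<sigma> \<in> L\<close>] j \<open>i \<in> _\<close> by auto
      then show ?thesis
        by (simp add: logit_def T0_def mat_app_column)
    qed
    have "att_vec T0 \<sigma> i c = (\<Sum>j\<in>{1..i}. if idx (\<sigma> !. j) = c then att_weight T0 \<sigma> i j else 0)"
      unfolding att_vec_def by (intro sum.cong) (auto simp: T0_def E_def)
    also have "\<dots> = (\<Sum>j | j \<in> {1..i} \<and> idx (\<sigma> !. j) = c. att_weight T0 \<sigma> i j)"
      by (subst sum.inter_filter) auto
    also have "\<dots> = (\<Sum>j | j \<in> {1..i} \<and> idx (\<sigma> !. j) = c. exp (logit T0 \<sigma> i j)) /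
        (\<Sum>j=1..i. exp (logit T0 \<sigma> i j))"
      by (simp add: att_weight_def sum_divide_distrib)
    also have "\<dots> = (\<Sum>j | j \<in> {1..i} \<and> idx (\<sigma> !. j) = c.
       exp (key (\<sigma> !. j) \<bullet> (matpow (rho \<theta>) (i - j) *v query (\<sigma> !. i)))) /
      (\<Sum>j=1..i. exp (key (\<sigma> !. j) \<bullet> (matpow (rho \<theta>) (i - j) *v query (\<sigma> !. i))))"
      by (intro arg_cong2[where f = "(/)"] sum.cong) (auto simp: logit)
    finally show ?thesis .
  qed
  have att_share: "att_vec T0 \<sigma> i (idx s) = share key query \<theta> \<sigma> i s"
    if "\<sigma> \<in> L" "i \<in> {1..length \<sigma>}" "s \<in> \<Sigma>" for \<sigma> i s
  proof -
    have "{j. j \<in> {1..i} \<and> idx (\<sigma> !. j) = idx s} = {j. j \<in> {1..i} \<and> \<sigma> !. j = s}"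
      using mem[OF that(1)] that(2,3) idx(2) by (fastforce dest: inj_onD)
    then show ?thesis
      unfolding att[OF that(1,2)] share_def by simp
  qed
  have att_top: "att_vec T0 \<sigma> i \<in> topspace (Euclidean_space d)"
    if "\<sigma> \<in> L" "i \<in> {1..length \<sigma>}" for \<sigma> i
  proof -
    have "att_vec T0 \<sigma> i c = 0" if "c \<ge> d" for c
    proof -
      have "{j. j \<in> {1..i} \<and> idx (\<sigma> !. j) = c} = {}"
        using mem[OF \<open>\<sigma> \<in> L\<close>] \<open>i \<in> _\<close> idx_less that by fastforce
      then show ?thesis
        unfolding att[OF \<open>\<sigma> \<in> L\<close> \<open>i \<in> _\<close>] by (simp only: sum.empty div_0)
    qed
    then show ?thesis
      by (simp add: topspace_Euclidean_space)
  qed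
  define X where "X = (SIGMA \<sigma>:L. {1..length \<sigma>})"
  define pt where "pt = (\<lambda>(\<sigma>, i). (E (\<sigma> !. i), att_vec T0 \<sigma> i))"
  define g where "g = (\<lambda>(\<sigma>, i). f \<sigma> !. i)"
  have finite_X: "finite X"
    unfolding X_def using \<open>finite L\<close> by blast
  have pt_top: "pt \<in> X \<rightarrow> topspace (prod_topology (Euclidean_space d) (Euclidean_space d))"
    using E_top mem att_top by (auto simp: X_def pt_def)
  have g_in: "g \<in> X \<rightarrow> \<Sigma>"
    using f by (fastforce simp: X_def g_def subset_iff)
  have g_eq: "\<forall>x\<in>X. \<forall>y\<in>X. pt x = pt y \<longrightarrow> g x = g y"
  proof (intro ballI impI)
    fix x y assume xy_pt: "x \<in> X" "y \<in> X" "pt x = pt y"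
    obtain \<sigma> i \<sigma>' i' where xy: "x = (\<sigma>, i)" "y = (\<sigma>', i')"
      by fastforce
    have in_L: "\<sigma> \<in> L" "i \<in> {1..length \<sigma>}" "\<sigma>' \<in> L" "i' \<in> {1..length \<sigma>'}"
      using xy_pt(1,2) by (auto simp: X_def xy)
    have E_eq: "E (\<sigma> !. i) = E (\<sigma>' !. i')" and att_eq: "att_vec T0 \<sigma> i = att_vec T0 \<sigma>' i'"
      using xy_pt(3) by (simp_all add: pt_def xy)
    from E_eq have "idx (\<sigma> !. i) = idx (\<sigma>' !. i')"
      unfolding E_def fun_eq_iff by (metis zero_neq_one)
    then have "\<sigma> !. i = \<sigma>' !. i'"
      using idx(2) mem in_L by (meson inj_onD)
    moreover have "\<forall>s\<in>\<Sigma>. share key query \<theta> \<sigma> i s = share key query \<theta> \<sigma>' i' s"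
      using att_eq in_L by (metis att_share)
    ultimately show "g x = g y"
      unfolding g_def xy case_prod_conv by (rule sep[OF in_L])
  qed
  obtain G where
    G_cont: "continuous_map (prod_topology (Euclidean_space d) (Euclidean_space d))
      (powertop_real \<Sigma>) (\<lambda>(x, a). G x a)" and
    G_max: "\<forall>x\<in>X. {s. is_arg_max (G (fst (pt x)) (snd (pt x))) (\<lambda>s. s \<in> \<Sigma>) s} = {g x}"
    using continuous_scores_exist[OF finite_X pt_top g_in g_eq] by (elim exE conjE)
  define T where "T = T0\<lparr>Out := G\<rparr>"
  have att_T: "att_vec T = att_vec T0"
    by (intro ext) (simp add: att_vec_def att_weight_def logit_def T_def)
  have "transformer_over \<Sigma> T"
    using \<open>\<theta> > 0\<close> G_cont E_top by (auto simp: transformer_over_def T_def T0_def d_def)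
  moreover have "outputs \<Sigma> T \<sigma> (f \<sigma>)" if "\<sigma> \<in> L" for \<sigma>
  proof -
    have "{s. is_arg_max (Out T (emb T (\<sigma> !. i)) (att_vec T \<sigma> i)) (\<lambda>s. s \<in> \<Sigma>) s} = {f \<sigma> !. i}"
      if "i \<in> {1..length \<sigma>}" for i
      using bspec[OF G_max, of "(\<sigma>, i)"] \<open>\<sigma> \<in> L\<close> that
      by (simp add: att_T X_def pt_def g_def) (simp add: T_def T0_def)
    then show ?thesis
      using f[OF that] by (simp add: outputs_def)
  qed
  ultimately show ?thesis
    by blast
qed


subsection \<open>The letter task\<close>

text \<open>Exponentials are positive, so the numerator vanishes only if its index set is empty,
  whatever the keys and queries; \<open>i \<ge> 1\<close> makes the denominator positive.\<close>

lemma share_pos_iff: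
  assumes "i \<ge> 1"
  shows "share key query \<theta> \<sigma> i s > 0 \<longleftrightarrow> (\<exists>j\<in>{1..i}. \<sigma> !. j = s)"
proof -
  have "(\<Sum>j | j \<in> {1..i} \<and> \<sigma> !. j = s.
      exp (key (\<sigma> !. j) \<bullet> (matpow (rho \<theta>) (i - j) *v query (\<sigma> !. i)))) > 0"
    if "j \<in> {1..i}" "\<sigma> !. j = s" for j
    using that by (intro sum_pos) auto
  moreover have "(\<Sum>j | j \<in> {1..i} \<and> \<sigma> !. j = s.
      exp (key (\<sigma> !. j) \<bullet> (matpow (rho \<theta>) (i - j) *v query (\<sigma> !. i)))) = 0"
    if "\<not> (\<exists>j\<in>{1..i}. \<sigma> !. j = s)"
    using that by (intro sum.neutral) auto
  moreover have "(\<Sum>j=1..i. exp (key (\<sigma> !. j) \<bullet> (matpow (rho \<theta>) (i - j) *v query (\<sigma> !. i)))) > 0"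
    using assms by (intro sum_pos) auto
  ultimately show ?thesis
    unfolding share_def zero_less_divide_iff by (smt (verit))
qed

section \<open>Values of the retrieval function\<close>

lemma nth1_map_positions: "j \<in> {1..n} \<Longrightarrow> map h [1..<n + 1] !. j = h j"
  by (auto simp add: nth_upt simp del: upt_Suc)

lemma Retrieval_nth:
  assumes "j \<in> {1..length \<sigma>}"
  shows "Retrieval \<sigma> !. j =
    (if isl (snd (\<sigma> !. j)) then \<sigma> !. (SOME k. retrieval_pos \<sigma> j k) else \<sigma> !. j)"
  unfolding Retrieval_def by (rule nth1_map_positions[OF assms])

text \<open>Trades the choice operator for a witness. All admissible positions carry the same
  symbol, so by the last clause any candidate found later identifies the answer.\<close>

lemma Retrieval_letter:
  assumes "proper \<sigma>" "j \<in> {1..length \<sigma>}" "isl (snd (\<sigma> !. j))"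
  obtains k where "k \<in> {1..j}" "Retrieval \<sigma> !. j = \<sigma> !. k" "Inl (fst (\<sigma> !. k)) = snd (\<sigma> !. j)"
    "\<And>k'. k' \<in> {1..j} \<Longrightarrow> Inl (fst (\<sigma> !. k')) = snd (\<sigma> !. j) \<Longrightarrow> \<sigma> !. k' = \<sigma> !. k"
proof -
  define k where "k = (SOME k. retrieval_pos \<sigma> j k)"
  have "\<exists>k. retrieval_pos \<sigma> j k"
    using assms unfolding proper_def by blast
  then have "retrieval_pos \<sigma> j k"
    unfolding k_def by (rule someI_ex)
  then have k: "k \<in> {1..j}" "Inl (fst (\<sigma> !. k)) = snd (\<sigma> !. j)"
    "\<forall>k'\<in>{1..j}. k' \<noteq> k \<and> Inl (fst (\<sigma> !. k')) = snd (\<sigma> !. j) \<longrightarrow> \<sigma> !. k' = \<sigma> !. k"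
    unfolding retrieval_pos_def by blast+
  have "Retrieval \<sigma> !. j = \<sigma> !. k"
    unfolding k_def using Retrieval_nth[OF assms(2)] assms(3) by (simp only: if_True)
  then show thesis
    using k by (intro that[of k]) metis+
qed

lemma set_Retrieval_subset:
  assumes "proper \<sigma>"
  shows "set (Retrieval \<sigma>) \<subseteq> set \<sigma>"
proof
  fix s assume "s \<in> set (Retrieval \<sigma>)"
  then obtain j where "j \<in> set [1..<length \<sigma> + 1]" and s: "s =
      (if isl (snd (\<sigma> !. j)) then \<sigma> !. (SOME k. retrieval_pos \<sigma> j k) else \<sigma> !. j)"
    unfolding Retrieval_def set_map by (rule imageE)
  then have j: "j \<in> {1..length \<sigma>}"
    by auto
  have nth: "\<sigma> !. k \<in> set \<sigma>" if "k \<in> {1..j}" for k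
    using that j by auto
  show "s \<in> set \<sigma>"
  proof (cases "isl (snd (\<sigma> !. j))")
    case True
    then obtain k where "k \<in> {1..j}" "Retrieval \<sigma> !. j = \<sigma> !. k"
      by (rule Retrieval_letter[OF assms j])
    moreover have "s = Retrieval \<sigma> !. j"
      unfolding s by (rule Retrieval_nth[OF j, symmetric])
    ultimately show ?thesis
      using nth by metis
  next
    case False
    then have "s = \<sigma> !. j"
      unfolding s by (rule if_not_P)
    moreover have "j \<in> {1..j}"
      using j by simp
    ultimately show ?thesis
      using nth by metis
  qed
qed

lemma valid_letter_subset:
  assumes "valid_letter A m \<sigma>"
  shows "set \<sigma> \<subseteq> retrieval_vocab A m"
proof -
  obtain ps qs where
    "\<sigma> = map (\<lambda>(s, w). (s, Inr w)) ps @ map (\<lambda>(x, y). (x, Inl y)) qs"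
    "set ps \<subseteq> A \<times> {1..m}" "set qs \<subseteq> A \<times> A"
    using assms unfolding valid_letter_def by blast
  then show ?thesis
    by (auto simp: retrieval_vocab_def)
qed

lemma retrieval_transformer:
  fixes A :: "'a set"
  assumes "finite A"
  shows "\<exists>T. transformer_over (retrieval_vocab A m) T \<and>
    (\<forall>\<sigma>. valid_letter A m \<sigma> \<and> length \<sigma> \<le> n0 \<longrightarrow> outputs (retrieval_vocab A m) T \<sigma> (Retrieval \<sigma>))"
proof -
  define \<Sigma> where "\<Sigma> = retrieval_vocab A m"
  define L where "L = {\<sigma>. valid_letter A m \<sigma> \<and> length \<sigma> \<le> n0}"
  have "finite \<Sigma>"
    using assms by (simp add: \<Sigma>_def retrieval_vocab_def)
  have L_sub: "set \<sigma> \<subseteq> \<Sigma>" if "\<sigma> \<in> L" for \<sigma>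
    using that valid_letter_subset by (auto simp: L_def \<Sigma>_def)
  have L_proper: "proper \<sigma>" if "\<sigma> \<in> L" for \<sigma>
    using that by (auto simp: L_def valid_letter_def)
  have "finite L"
    using L_sub by (intro finite_subset[OF _ finite_lists_length_le[OF \<open>finite \<Sigma>\<close>]])
      (auto simp: L_def)
  have "\<exists>T. transformer_over \<Sigma> T \<and> (\<forall>\<sigma>\<in>L. outputs \<Sigma> T \<sigma> (Retrieval \<sigma>))"
  proof (rule transformer_if_shares_separate[OF \<open>finite \<Sigma>\<close> zero_less_one \<open>finite L\<close> L_sub])
    show "length (Retrieval \<sigma>) = length \<sigma> \<and> set (Retrieval \<sigma>) \<subseteq> \<Sigma>" if "\<sigma> \<in> L" for \<sigma>
      using set_Retrieval_subset[OF L_proper[OF that]] L_sub[OF that]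
        by (auto simp: Retrieval_def simp del: upt_Suc)
  next
    fix \<sigma> i \<sigma>' i'
    assume \<sigma>: "\<sigma> \<in> L" "i \<in> {1..length \<sigma>}" and \<sigma>': "\<sigma>' \<in> L" "i' \<in> {1..length \<sigma>'}"
      and cur: "\<sigma> !. i = \<sigma>' !. i'"
      \<comment> \<open>Zero keys and queries make all logits 0, so attention is uniform; the angle
        1 is an arbitrary positive value.\<close>
      and eq: "\<forall>s\<in>\<Sigma>. share (\<lambda>_. 0) (\<lambda>_. 0) 1 \<sigma> i s = share (\<lambda>_. 0) (\<lambda>_. 0) 1 \<sigma>' i' s"
    show "Retrieval \<sigma> !. i = Retrieval \<sigma>' !. i'"
    proof (cases "isl (snd (\<sigma> !. i))")
      case True
      then obtain k where k: "k \<in> {1..i}" "Retrieval \<sigma> !. i = \<sigma> !. k"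
          "Inl (fst (\<sigma> !. k)) = snd (\<sigma> !. i)"
        using Retrieval_letter[OF L_proper] \<sigma> by metis
      obtain k' where k': "Retrieval \<sigma>' !. i' = \<sigma>' !. k'"
          "\<And>l. l \<in> {1..i'} \<Longrightarrow> Inl (fst (\<sigma>' !. l)) = snd (\<sigma>' !. i') \<Longrightarrow> \<sigma>' !. l = \<sigma>' !. k'"
        using Retrieval_letter[OF L_proper] \<sigma>' True cur by metis
      have "\<sigma> !. k \<in> \<Sigma>"
        using L_sub[OF \<sigma>(1)] k(1) \<sigma>(2) nth_mem[of "k - 1" \<sigma>] by auto
      moreover have "i \<ge> 1" "i' \<ge> 1"
        using \<sigma>(2) \<sigma>'(2) by auto
      \<comment> \<open>The answer for \<open>\<sigma>\<close> has a positive share there, hence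
        also in \<open>\<sigma>'\<close>. As the current symbols agree, its occurrence in
        \<open>\<sigma>'\<close> is a candidate, and all candidates equal the answer for
        \<open>\<sigma>'\<close>.\<close>
      ultimately have "\<exists>l\<in>{1..i'}. \<sigma>' !. l = \<sigma> !. k"
        using share_pos_iff eq k(1) by metis
      then obtain l where "l \<in> {1..i'}" "\<sigma>' !. l = \<sigma> !. k"
        by blast
      then show ?thesis
        using k k' cur by metis
    next
      case False
      then show ?thesis
        using Retrieval_nth \<sigma> \<sigma>' cur by metis
    qed
  qed
  then show ?thesis
    by (auto simp: L_def \<Sigma>_def)
qed


subsection \<open>The number task\<close>

text \<open>With unit vectors written by their angle, each factor \<open>rho \<theta>\<close> adds
  \<open>\<theta>\<close> by the addition formulas; logits thereby become single cosines.\<close>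

lemma matpow_rho_mult_vector:
  "matpow (rho \<theta>) t *v vector [cos \<phi>, sin \<phi>] =
    (vector [cos (real t * \<theta> + \<phi>), sin (real t * \<theta> + \<phi>)] :: real^2)"
proof (induction t)
  case 0
  then show ?case
    by (simp add: matrix_vector_mul_lid)
next
  case (Suc t)
  have "matpow (rho \<theta>) (Suc t) *v vector [cos \<phi>, sin \<phi>] =
      rho \<theta> *v vector [cos (real t * \<theta> + \<phi>), sin (real t * \<theta> + \<phi>)]"
    by (simp add: Suc.IH flip: matrix_vector_mul_assoc)
  also have "\<dots> = vector [cos (\<theta> + (real t * \<theta> + \<phi>)), sin (\<theta> + (real t * \<theta> + \<phi>))]"
    by (simp add: rho_def vec_eq_iff forall_2 matrix_vector_mult_def sum_2 cos_add sin_add)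
  finally show ?case
    by (simp add: algebra_simps)
qed

text \<open>All letters share one key on the first axis, so their logits depend on the distance
  alone. The zero key of numbers fixes their unnormalised weight at 1, a reference against which
  letters are measured.\<close>

definition index_key :: "real \<Rightarrow> 'a + nat \<Rightarrow> real^2"
  where "index_key C s = (case s of Inl _ \<Rightarrow> vector [C, 0] | Inr _ \<Rightarrow> 0)"

text \<open>The query of \<open>r\<close> lags \<open>r\<close> rotation steps behind the letter
  key, so the rotation at distance \<open>r\<close> aligns the two. At a letter the current symbol
  is already the answer, so the query may be 0.\<close>

definition index_query :: "real \<Rightarrow> 'a + nat \<Rightarrow> real^2"
  where "index_query \<theta> s =
    (case s of Inl _ \<Rightarrow> 0 | Inr r \<Rightarrow> vector [cos (- (real r * \<theta>)), sin (- (real r * \<theta>))])"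

lemma index_logit:
  "index_key C s \<bullet> (matpow (rho \<theta>) t *v index_query \<theta> (Inr r)) =
    (if isl s then C * cos ((real t - real r) * \<theta>) else 0)"
proof (cases s)
  case (Inl a)
  have "index_key C s \<bullet> (matpow (rho \<theta>) t *v index_query \<theta> (Inr r)) =
      C * cos (real t * \<theta> + - (real r * \<theta>))"
    unfolding index_query_def sum.case matpow_rho_mult_vector
    by (simp add: Inl index_key_def inner_vec_def sum_2)
  then show ?thesis
    by (simp add: Inl algebra_simps)
qed (simp add: index_key_def)

section \<open>Values of the index function and the vocabulary of its inputs\<close>

lemma Index_nth:
  assumes "j \<in> {1..length \<sigma>}"
  shows "Index \<sigma> !. j = (case \<sigma> !. j of
      Inr i \<Rightarrow> if i < j \<and> isl (\<sigma> !. (j - i)) then \<sigma> !. (j - i) else \<sigma> !. j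
    | Inl _ \<Rightarrow> \<sigma> !. j)"
  unfolding Index_def by (rule nth1_map_positions[OF assms])

lemma set_Index_subset: "set (Index \<sigma>) \<subseteq> set \<sigma>"
proof
  fix s assume "s \<in> set (Index \<sigma>)"
  then obtain j where "j \<in> set [1..<length \<sigma> + 1]" and s: "s = (case \<sigma> !. j of
      Inr i \<Rightarrow> if i < j \<and> isl (\<sigma> !. (j - i)) then \<sigma> !. (j - i) else \<sigma> !. j
    | Inl _ \<Rightarrow> \<sigma> !. j)"
    unfolding Index_def set_map by (rule imageE)
  then have j: "1 \<le> j" "j \<le> length \<sigma>"
    by auto
  have nth: "\<sigma> !. (j - i) \<in> set \<sigma>" if "i < j" for i
    using that j by (intro nth_mem) linarith
  have cur: "\<sigma> !. j \<in> set \<sigma>"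
    using nth[of 0] j by simp
  show "s \<in> set \<sigma>"
  proof (cases "\<sigma> !. j")
    case (Inl a)
    then have "s = \<sigma> !. j"
      unfolding s by simp
    then show ?thesis
      using cur by metis
  next
    case (Inr i)
    then have "s = (if i < j \<and> isl (\<sigma> !. (j - i)) then \<sigma> !. (j - i) else \<sigma> !. j)"
      unfolding s by simp
    then show ?thesis
      using cur nth[of i] by metis
  qed
qed

lemma valid_number_subset:
  assumes "valid_number A m \<sigma>"
  shows "set \<sigma> \<subseteq> index_vocab A m"
proof -
  obtain ss js where "\<sigma> = map Inl ss @ map Inr js" "set ss \<subseteq> A" "set js \<subseteq> {1..m}"
    using assms unfolding valid_number_def by blast
  then show ?thesis
    by (auto simp: index_vocab_def)
qed

section \<open>Choice of the angle and of the scale of the logits\<close>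

text \<open>
  The constant \<open>N\<^sup>2\<close> arises from cross-multiplying the two shares: a sum of at most \<open>N\<close> weights is
  multiplied by the number of occurrences of a symbol, which is at most \<open>N\<close>.
\<close>

lemma peaked_logits_exist:
  assumes "N \<ge> 1"
  obtains \<theta> C :: real where "\<theta> > 0"
    "\<And>t r. \<lbrakk>t \<le> N; r \<le> N; t \<noteq> r\<rbrakk> \<Longrightarrow>
      real N ^ 2 * exp (C * cos ((real t - real r) * \<theta>)) < exp C"
proof -
  \<comment> \<open>Differences of up to \<open>N\<close> steps then stay within a half turn, where
    the cosine decreases, so \<open>cos \<theta>\<close> bounds all values off the peak.\<close>
  define \<theta> where "\<theta> = pi / real N"
  \<comment> \<open>Solves \<open>(N^2 + 1) * exp (C * cos \<theta>) = exp C\<close>.\<close>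
  define C where "C = ln (real N ^ 2 + 1) / (1 - cos \<theta>)"
  have "\<theta> > 0" "\<theta> \<le> pi"
    using assms by (auto simp: \<theta>_def field_simps)
  then have "cos \<theta> < 1"
    using cos_monotone_0_pi[of 0 \<theta>] by simp
  moreover have "ln (real N ^ 2 + 1) > 0"
    using assms by (intro ln_gt_zero) simp
  ultimately have "C > 0" and C: "C * (1 - cos \<theta>) = ln (real N ^ 2 + 1)"
    by (auto simp: C_def)
  have "real N ^ 2 * exp (C * cos ((real t - real r) * \<theta>)) < exp C"
    if "t \<le> N" "r \<le> N" "t \<noteq> r" for t r
  proof -
    have "\<bar>real t - real r\<bar> \<ge> 1" "\<bar>real t - real r\<bar> \<le> real N"
      using that by linarith+
    then have "\<theta> \<le> \<bar>real t - real r\<bar> * \<theta>" "\<bar>real t - real r\<bar> * \<theta> \<le> pi"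
      using \<open>\<theta> > 0\<close> assms mult_right_mono[of _ _ \<theta>] by (fastforce, fastforce simp: \<theta>_def field_simps)
    then have "cos (\<bar>real t - real r\<bar> * \<theta>) \<le> cos \<theta>"
      using \<open>\<theta> > 0\<close> by (intro cos_monotone_0_pi_le) auto
    moreover have "cos (\<bar>real t - real r\<bar> * \<theta>) = cos ((real t - real r) * \<theta>)"
      by (simp add: abs_if) (metis cos_minus minus_diff_eq mult_minus_left)
    ultimately have "C * cos ((real t - real r) * \<theta>) \<le> C * cos \<theta>"
      using \<open>C > 0\<close> by simp
    then have "real N ^ 2 * exp (C * cos ((real t - real r) * \<theta>)) \<le> real N ^ 2 * exp (C * cos \<theta>)"
      by (intro mult_left_mono) auto
    also have "\<dots> < (real N ^ 2 + 1) * exp (C * cos \<theta>)"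
      by simp
    also have "\<dots> = exp (C * (1 - cos \<theta>)) * exp (C * cos \<theta>)"
      unfolding C by (subst exp_ln) (auto intro: add_nonneg_pos)
    also have "\<dots> = exp C"
      by (simp add: algebra_simps flip: exp_add)
    finally show ?thesis .
  qed
  with \<open>\<theta> > 0\<close> show thesis
    by (rule that)
qed

text \<open>The quotient of the shares of \<open>Inl a\<close> and \<open>Inr r\<close> is free of
  the normalisation. With \<open>a\<close> at distance \<open>r\<close> it is at least
  \<open>exp C / N\<close>: one weight is \<open>exp C\<close> and the count of \<open>Inr r\<close>
  is at most \<open>N\<close>. Otherwise it is below \<open>exp C / N\<close>: fewer than
  \<open>N\<close> weights, each below \<open>exp C / N^2\<close>, over a count of at least
  1.\<close>

lemma index_letter_transfer:
  fixes \<sigma> \<sigma>' :: "('a + nat) list"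
  assumes peak: "\<And>t r. \<lbrakk>t \<le> N; r \<le> N; t \<noteq> r\<rbrakk> \<Longrightarrow>
      real N ^ 2 * exp (C * cos ((real t - real r) * \<theta>)) < exp C"
    and i: "1 \<le> i" "i \<le> N" and i': "1 \<le> i'" "i' \<le> N" and "r \<le> N"
    and cur: "\<sigma> !. i = Inr r" "\<sigma>' !. i' = Inr r"
    and eq: "share (index_key C) (index_query \<theta>) \<theta> \<sigma> i (Inl a) =
        share (index_key C) (index_query \<theta>) \<theta> \<sigma>' i' (Inl a)"
      "share (index_key C) (index_query \<theta>) \<theta> \<sigma> i (Inr r) =
        share (index_key C) (index_query \<theta>) \<theta> \<sigma>' i' (Inr r)"
    and hit: "r < i" "\<sigma> !. (i - r) = Inl a"
  shows "r < i' \<and> \<sigma>' !. (i' - r) = Inl a"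
proof (rule ccontr)
  assume miss: "\<not> (r < i' \<and> \<sigma>' !. (i' - r) = Inl a)"
  define letter where "letter \<sigma> i =
    (\<Sum>j | j \<in> {1..i} \<and> \<sigma> !. j = Inl a. exp (C * cos ((real (i - j) - real r) * \<theta>)))"
    for \<sigma> :: "('a + nat) list" and i
  define total where "total \<sigma> i = (\<Sum>j=1..i.
      exp (index_key C (\<sigma> !. j) \<bullet> (matpow (rho \<theta>) (i - j) *v index_query \<theta> (Inr r))))"
    for \<sigma> :: "('a + nat) list" and i
  \<comment> \<open>Numbers have logit 0, so each occurrence weighs \<open>exp 0 = 1\<close> and the
    numerator of the share of \<open>Inr r\<close> is this count.\<close>
  define count where "count \<sigma> i = card {j. j \<in> {1..i} \<and> \<sigma> !. j = Inr r}"
    for \<sigma> :: "('a + nat) list" and i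
  have share_letter: "share (index_key C) (index_query \<theta>) \<theta> \<sigma> i (Inl a) = letter \<sigma> i / total \<sigma> i"
    if "\<sigma> !. i = Inr r" for \<sigma> :: "('a + nat) list" and i
    unfolding share_def that index_logit letter_def total_def
    by (intro arg_cong2[where f = "(/)"] sum.cong) auto
  have share_count: "share (index_key C) (index_query \<theta>) \<theta> \<sigma> i (Inr r) = real (count \<sigma> i) / total \<sigma> i"
    if "\<sigma> !. i = Inr r" for \<sigma> :: "('a + nat) list" and i
    unfolding share_def that index_logit count_def total_def
    by (intro arg_cong2[where f = "(/)"]) auto
  have total_pos: "total \<sigma> i > 0" if "i \<ge> 1" for \<sigma> :: "('a + nat) list" and i
    unfolding total_def using that by (intro sum_pos) auto
  have count_le: "count \<sigma> i \<le> i" for \<sigma> :: "('a + nat) list" and i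
  proof -
    have "count \<sigma> i \<le> card {1..i}"
      unfolding count_def by (intro card_mono) auto
    then show ?thesis by simp
  qed
  have count_pos: "count \<sigma>' i' \<ge> 1"
  proof -
    have "card {i'} \<le> count \<sigma>' i'"
      unfolding count_def using i' cur by (intro card_mono) auto
    then show ?thesis by simp
  qed
  \<comment> \<open>Equality of the two quotients, cross-multiplied; combining the two share
    equations cancels both totals.\<close>
  have ratio: "letter \<sigma> i * real (count \<sigma>' i') = letter \<sigma>' i' * real (count \<sigma> i)"
  proof -
    have 1: "letter \<sigma> i * total \<sigma>' i' = letter \<sigma>' i' * total \<sigma> i"
      and 2: "real (count \<sigma> i) * total \<sigma>' i' = real (count \<sigma>' i') * total \<sigma> i"
      using eq[unfolded share_letter[OF cur(1)] share_letter[OF cur(2)]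
          share_count[OF cur(1)] share_count[OF cur(2)]]
        total_pos[OF i(1), of \<sigma>] total_pos[OF i'(1), of \<sigma>']
      by (simp_all add: frac_eq_eq)
    have "letter \<sigma> i * real (count \<sigma>' i') * (total \<sigma> i * total \<sigma>' i') =
        letter \<sigma> i * total \<sigma>' i' * (real (count \<sigma>' i') * total \<sigma> i)"
      by (simp add: algebra_simps)
    also have "\<dots> = letter \<sigma>' i' * real (count \<sigma> i) * (total \<sigma> i * total \<sigma>' i')"
      unfolding 1 2[symmetric] by (simp add: algebra_simps)
    finally show ?thesis
      using total_pos[OF i(1), of \<sigma>] total_pos[OF i'(1), of \<sigma>'] by simp
  qed
  \<comment> \<open>The summand at \<open>j = i - r\<close> has cosine 1.\<close>
  have "exp C \<le> letter \<sigma> i"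
  proof -
    have "exp (C * cos ((real (i - (i - r)) - real r) * \<theta>)) \<le> letter \<sigma> i"
      unfolding letter_def using hit by (intro member_le_sum) auto
    then show ?thesis
      using hit by simp
  qed
  also have "\<dots> \<le> letter \<sigma> i * real (count \<sigma>' i')"
  proof -
    have "letter \<sigma> i \<ge> 0"
      unfolding letter_def by (intro sum_nonneg) auto
    then show ?thesis
      using count_pos mult_left_mono[of 1 "real (count \<sigma>' i')" "letter \<sigma> i"] by simp
  qed
  also have "\<dots> = letter \<sigma>' i' * real (count \<sigma> i)"
    by (rule ratio)
  \<comment> \<open>The factor \<open>N\<close> pays for the number of summands on the right, once
    \<open>peak\<close> has used up \<open>N^2\<close> on each of them.\<close>
  finally have "exp C * real N \<le> letter \<sigma>' i' * real (count \<sigma> i) * real N"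
    by (intro mult_right_mono) auto
  also have "\<dots> \<le> letter \<sigma>' i' * (real N * real N)"
  proof -
    have "letter \<sigma>' i' \<ge> 0"
      unfolding letter_def by (intro sum_nonneg) auto
    moreover have "count \<sigma> i \<le> N"
      using count_le[of \<sigma> i] i by simp
    ultimately show ?thesis
      unfolding mult.assoc by (intro mult_left_mono mult_right_mono) auto
  qed
  also have "\<dots> = (\<Sum>j | j \<in> {1..i'} \<and> \<sigma>' !. j = Inl a.
      real N ^ 2 * exp (C * cos ((real (i' - j) - real r) * \<theta>)))"
    by (simp add: letter_def sum_distrib_left power2_eq_square mult.commute)
  also have "\<dots> \<le> (\<Sum>j | j \<in> {1..i'} \<and> \<sigma>' !. j = Inl a. exp C)"
  proof (rule sum_mono)
    fix j assume j: "j \<in> {j \<in> {1..i'}. \<sigma>' !. j = Inl a}"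
    have "i' - j \<noteq> r"
    proof
      assume "i' - j = r"
      then have "r < i'" "j = i' - r"
        using j by auto
      then show False
        using miss j by simp
    qed
    then show "real N ^ 2 * exp (C * cos ((real (i' - j) - real r) * \<theta>)) \<le> exp C"
      using peak[of "i' - j" r] i'(2) \<open>r \<le> N\<close> by (simp add: less_imp_le)
  qed
  \<comment> \<open>Position \<open>i'\<close> holds a number, so at most \<open>i' - 1\<close>
    summands remain. This yields the strict inequality, since the termwise bound is kept
    weak.\<close>
  also have "\<dots> \<le> real (card {1..<i'}) * exp C"
  proof -
    have "{j. j \<in> {1..i'} \<and> \<sigma>' !. j = Inl a} \<subseteq> {1..<i'}"
      using cur by (auto simp: le_less)
    then have "card {j. j \<in> {1..i'} \<and> \<sigma>' !. j = Inl a} \<le> card {1..<i'}"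
      by (intro card_mono) auto
    then show ?thesis
      by (simp only: sum_constant) (intro mult_right_mono, auto)
  qed
  also have "\<dots> < exp C * real N"
    using i' by simp
  finally show False
    by simp
qed

text \<open>Transfer in both directions shows that two inputs with the same current number and
  shares have the same letter, or none, at the distance it names.\<close>

lemma index_transformer:
  fixes A :: "'a set"
  assumes "finite A"
  shows "\<exists>T. transformer_over (index_vocab A m) T \<and>
    (\<forall>\<sigma>. valid_number A m \<sigma> \<and> length \<sigma> \<le> n0 \<longrightarrow> outputs (index_vocab A m) T \<sigma> (Index \<sigma>))"
proof -
  define \<Sigma> where "\<Sigma> = index_vocab A m"
  define L where "L = {\<sigma>. valid_number A m \<sigma> \<and> length \<sigma> \<le> n0}"
  \<comment> \<open>Bounds both the input lengths and the numbers up to \<open>m\<close>, so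
    \<open>peak\<close> covers every distance and every query; the 1 makes it positive.\<close>
  define N where "N = n0 + m + 1"
  obtain \<theta> C :: real where "\<theta> > 0" and
    peak: "\<And>t r. \<lbrakk>t \<le> N; r \<le> N; t \<noteq> r\<rbrakk> \<Longrightarrow>
      real N ^ 2 * exp (C * cos ((real t - real r) * \<theta>)) < exp C"
    using peaked_logits_exist[of N] by (auto simp: N_def)
  have "finite \<Sigma>"
    using assms by (simp add: \<Sigma>_def index_vocab_def)
  have L_sub: "set \<sigma> \<subseteq> \<Sigma>" if "\<sigma> \<in> L" for \<sigma>
    using that valid_number_subset by (auto simp: L_def \<Sigma>_def)
  have L_le: "length \<sigma> \<le> N" if "\<sigma> \<in> L" for \<sigma>
    using that by (simp add: L_def N_def)
  have mem: "\<sigma> !. j \<in> \<Sigma>" if "\<sigma> \<in> L" "j \<in> {1..length \<sigma>}" for \<sigma> j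
    using L_sub[OF that(1)] that(2) by (auto simp: subset_iff)
  have "finite L"
    using L_sub by (intro finite_subset[OF _ finite_lists_length_le[OF \<open>finite \<Sigma>\<close>]])
      (auto simp: L_def)
  have "\<exists>T. transformer_over \<Sigma> T \<and> (\<forall>\<sigma>\<in>L. outputs \<Sigma> T \<sigma> (Index \<sigma>))"
  proof (rule transformer_if_shares_separate[OF \<open>finite \<Sigma>\<close> \<open>\<theta> > 0\<close> \<open>finite L\<close> L_sub])
    show "length (Index \<sigma>) = length \<sigma> \<and> set (Index \<sigma>) \<subseteq> \<Sigma>" if "\<sigma> \<in> L" for \<sigma>
      using set_Index_subset[of \<sigma>] L_sub[OF that]
        by (auto simp: Index_def simp del: upt_Suc)
  next
    fix \<sigma> i \<sigma>' i'
    assume \<sigma>: "\<sigma> \<in> L" "i \<in> {1..length \<sigma>}" and \<sigma>': "\<sigma>' \<in> L" "i' \<in> {1..length \<sigma>'}"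
      and cur: "\<sigma> !. i = \<sigma>' !. i'"
      and eq: "\<forall>s\<in>\<Sigma>. share (index_key C) (index_query \<theta>) \<theta> \<sigma> i s =
        share (index_key C) (index_query \<theta>) \<theta> \<sigma>' i' s"
    show "Index \<sigma> !. i = Index \<sigma>' !. i'"
    proof (cases "\<sigma> !. i")
      case (Inl b)
      then have "\<sigma>' !. i' = Inl b"
        using cur by simp
      with Inl show ?thesis
        using Index_nth[OF \<sigma>(2)] Index_nth[OF \<sigma>'(2)] by simp
    next
      case (Inr r)
      then have r: "\<sigma> !. i = Inr r" "\<sigma>' !. i' = Inr r" "Inr r \<in> \<Sigma>"
        using cur mem[OF \<sigma>] by simp_all
      then have "r \<le> N"
        by (auto simp: \<Sigma>_def index_vocab_def N_def)
      have bounds: "1 \<le> i" "i \<le> N" "1 \<le> i'" "i' \<le> N"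
        using \<sigma> \<sigma>' L_le[of \<sigma>] L_le[of \<sigma>'] by auto
      \<comment> \<open>Shares are compared on \<open>\<Sigma>\<close> only, hence the restriction
        on \<open>a\<close>.\<close>
      have iff: "r < i \<and> \<sigma> !. (i - r) = Inl a \<longleftrightarrow> r < i' \<and> \<sigma>' !. (i' - r) = Inl a"
        if "Inl a \<in> \<Sigma>" for a
        using index_letter_transfer[OF peak, of i i' r \<sigma> \<sigma>' a]
          index_letter_transfer[OF peak, of i' i r \<sigma>' \<sigma> a] bounds \<open>r \<le> N\<close> r eq that
        by metis
      show ?thesis
      proof (cases "\<exists>a. Inl a \<in> \<Sigma> \<and> r < i \<and> \<sigma> !. (i - r) = Inl a")
        case True
        then obtain a where "Inl a \<in> \<Sigma>" "r < i" "\<sigma> !. (i - r) = Inl a"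
          by blast
        then show ?thesis
          using iff[of a] Index_nth[OF \<sigma>(2)] Index_nth[OF \<sigma>'(2)] r by simp
      next
        case False
        have "\<not> (r < i \<and> isl (\<sigma> !. (i - r)))"
        proof
          assume *: "r < i \<and> isl (\<sigma> !. (i - r))"
          then have "i - r \<in> {1..length \<sigma>}"
            using \<sigma>(2) by auto
          then have "\<sigma> !. (i - r) \<in> \<Sigma>"
            by (rule mem[OF \<sigma>(1)])
          with * False show False
            by (metis isl_def)
        qed
        moreover have "\<not> (r < i' \<and> isl (\<sigma>' !. (i' - r)))"
        proof
          assume *: "r < i' \<and> isl (\<sigma>' !. (i' - r))"
          then have "i' - r \<in> {1..length \<sigma>'}"
            using \<sigma>'(2) by auto
          then have "\<sigma>' !. (i' - r) \<in> \<Sigma>"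
            by (rule mem[OF \<sigma>'(1)])
          with * False iff show False
            by (metis isl_def)
        qed
        ultimately show ?thesis
          unfolding Index_nth[OF \<sigma>(2)] Index_nth[OF \<sigma>'(2)] r sum.case by (simp only: if_False)
      qed
    qed
  qed
  then show ?thesis
    by (auto simp: L_def \<Sigma>_def)
qed

theorem theorem3p1:
  fixes A :: "'a set" and m n0 :: nat
  assumes "finite A" and "m \<ge> 1" and "n0 > 1"
  shows "(\<exists>T :: ('a + nat) transformer.
            transformer_over (index_vocab A m) T \<and>
            (\<forall>\<sigma>. valid_number A m \<sigma> \<and> length \<sigma> \<le> n0 \<longrightarrow>
                 outputs (index_vocab A m) T \<sigma> (Index \<sigma>)))
       \<and> (\<exists>T :: ('a \<times> ('a + nat)) transformer.
            transformer_over (retrieval_vocab A m) T \<and>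
            (\<forall>\<sigma>. valid_letter A m \<sigma> \<and> length \<sigma> \<le> n0 \<longrightarrow>
                 outputs (retrieval_vocab A m) T \<sigma> (Retrieval \<sigma>)))"
  using index_transformer[OF assms(1)] retrieval_transformer[OF assms(1)] by blast

end
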